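(* Let $L,M$ be frames with canonical extensions $e_L\colon L\to L^\delta$ and $e_M\colon M\to M^\delta$. If $h\colon L\to M$ is a perfect frame homomorphism, then $h^\delta\colon L^\delta\to M^\delta$ is a complete lattice homomorphism, that is, it preserves arbitrary joins and arbitrary meets.
   Context: A frame is a complete lattice in which finite meets distribute over arbitrary joins; frame homomorphisms preserve arbitrary joins and finite meets. A filter of a frame $L$ is an upset closed under finite meets (the improper filter is allowed). A filter $\kappa\subseteq L$ is Scott-open if, whenever $D\subseteq L$ is directed and $\bigvee D\in\kappa$, then $d\in\kappa$ for some $d\in D$. $L^{\wedge}$ denotes the set of Scott-open filters of $L$, ordered by reverse inclusion. A canonical extension of a frame $L$ is a monotone map $e\colon L\to L^\delta$ into a complete lattice $L^\delta$ such that: (Dense) for all $u,v\in L^\delta$: $u\le v$ holds provided that for all $\kappa\in L^{\wedge}$ and $a\in L$, the inequalities $\bigwedge e[\kappa]\le u$ and $v\le e(a)$ together imply $\bigwedge e[\kappa]\le e(a)$; (Compact) if $\bigwedge e[\kappa]\le e(a)$ for some $\kappa\in L^{\wedge}$ and $a\in L$, then $a\in\kappa$. Write $e^{\wedge}(\kappa)=\bigwedge e[\kappa]$ for $\kappa\in L^\wedge$. Every frame has a canonical extension, unique up to isomorphism. For a monotone map $f\colon L\to M$ between frames, define $f^\sigma,f^\pi\colon L^\delta\to M^\delta$ by $f^\sigma(u)=\bigvee\{\bigwedge e_M[f[\kappa]]\mid \kappa\in L^{\wedge},\ e_L^{\wedge}(\kappa)\le u\}$ and $f^\pi(u)=\bigwedge\{e_M(f(a))\mid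 a\in L,\ u\le e_L(a)\}$. If $f$ preserves directed joins and finite meets (in particular if $f$ is a frame homomorphism), then $f^\sigma=f^\pi$, and this common map is denoted $f^\delta$. A monotone map $f\colon L\to M$ between frames is perfect if for every $\kappa\in L^{\wedge}$ the smallest filter of $M$ containing $f[\kappa]$ is Scott-open. *)

theory Defs
  imports Main
begin

text \<open>
  The library class \<^class>\<open>complete_distrib_lattice\<close> is complete distributivity, which is strictly
  stronger than the frame law.
\<close>

class frame = complete_lattice +
  assumes inf_Sup_distrib: "inf a (Sup B) = (SUP b\<in>B. inf a b)"

definition frame_hom :: "('a::frame \<Rightarrow> 'b::frame) \<Rightarrow> bool" where
  "frame_hom h \<longleftrightarrow>
     (\<forall>A. h (Sup A) = Sup (h ` A)) \<and> h top = top \<and> (\<forall>a b. h (inf a b) = inf (h a) (h b))"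

definition complete_lattice_hom :: "('a::complete_lattice \<Rightarrow> 'b::complete_lattice) \<Rightarrow> bool" where
  "complete_lattice_hom h \<longleftrightarrow>
     (\<forall>A. h (Sup A) = Sup (h ` A)) \<and> (\<forall>A. h (Inf A) = Inf (h ` A))"

definition lattice_filter :: "'a::frame set \<Rightarrow> bool" where
  "lattice_filter F \<longleftrightarrow>
     (\<forall>a b. a \<in> F \<longrightarrow> a \<le> b \<longrightarrow> b \<in> F) \<and> top \<in> F \<and> (\<forall>a\<in>F. \<forall>b\<in>F. inf a b \<in> F)"

definition directed :: "'a::order set \<Rightarrow> bool" where
  "directed D \<longleftrightarrow> D \<noteq> {} \<and> (\<forall>a\<in>D. \<forall>b\<in>D. \<exists>c\<in>D. a \<le> c \<and> b \<le> c)"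

definition scott_open_filter :: "'a::frame set \<Rightarrow> bool" where
  "scott_open_filter K \<longleftrightarrow>
     lattice_filter K \<and> (\<forall>D. directed D \<longrightarrow> Sup D \<in> K \<longrightarrow> (\<exists>d\<in>D. d \<in> K))"

definition generated_filter :: "'a::frame set \<Rightarrow> 'a set" where
  "generated_filter S = \<Inter>{F. lattice_filter F \<and> S \<subseteq> F}"

definition perfect_map :: "('a::frame \<Rightarrow> 'b::frame) \<Rightarrow> bool" where
  "perfect_map f \<longleftrightarrow>
     mono f \<and> (\<forall>K. scott_open_filter K \<longrightarrow> scott_open_filter (generated_filter (f ` K)))"

definition canonical_extension :: "('a::frame \<Rightarrow> 'c::complete_lattice) \<Rightarrow> bool" where
  "canonical_extension e \<longleftrightarrow>
     mono e \<and>
     (\<forall>u v. (\<forall>K a. scott_open_filter K \<longrightarrow> Inf (e ` K) \<le> u \<longrightarrow> v \<le> e a \<longrightarrow> Inf (e ` K) \<le> e a)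
        \<longrightarrow> u \<le> v) \<and>
     (\<forall>K a. scott_open_filter K \<longrightarrow> Inf (e ` K) \<le> e a \<longrightarrow> a \<in> K)"

definition sigma_ext ::
  "('a::frame \<Rightarrow> 'c::complete_lattice) \<Rightarrow> ('b::frame \<Rightarrow> 'd::complete_lattice) \<Rightarrow> ('a \<Rightarrow> 'b) \<Rightarrow> 'c \<Rightarrow> 'd"
  where "sigma_ext eL eM f u =
    Sup {Inf (eM ` f ` K) | K. scott_open_filter K \<and> Inf (eL ` K) \<le> u}"

definition pi_ext ::
  "('a::frame \<Rightarrow> 'c::complete_lattice) \<Rightarrow> ('b::frame \<Rightarrow> 'd::complete_lattice) \<Rightarrow> ('a \<Rightarrow> 'b) \<Rightarrow> 'c \<Rightarrow> 'd"
  where "pi_ext eL eM f u = Inf {eM (f a) | a. u \<le> eL a}"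

text \<open>
  The common value of the two extensions; it is unspecified when they differ, and
  \<open>delta_ext_eq\<close> below shows that they agree for maps preserving directed joins and finite meets.
\<close>

definition delta_ext ::
  "('a::frame \<Rightarrow> 'c::complete_lattice) \<Rightarrow> ('b::frame \<Rightarrow> 'd::complete_lattice) \<Rightarrow> ('a \<Rightarrow> 'b) \<Rightarrow> 'c \<Rightarrow> 'd"
  where "delta_ext eL eM f = (THE g. g = sigma_ext eL eM f \<and> g = pi_ext eL eM f)"

lemma scott_open_filter_vimage:
  assumes "\<And>D. directed D \<Longrightarrow> f (Sup D) = Sup (f ` D)"
    and "f top = top" and inf: "\<And>a b. f (inf a b) = inf (f a) (f b)"
    and K: "scott_open_filter K"
  shows "scott_open_filter (f -` K)"
proof -
  have mono: "f a \<le> f b" if "a \<le> b" for a b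
    using that inf[of a b] by (simp add: inf.absorb_iff1)
  have dir: "directed (f ` D)" if "directed D" for D
    using that mono unfolding directed_def by blast
  have up: "b \<in> K" if "a \<in> K" "a \<le> b" for a b
    using K that unfolding scott_open_filter_def lattice_filter_def by blast
  have "lattice_filter (f -` K)"
    using K assms(2) inf up[OF _ mono]
    unfolding scott_open_filter_def lattice_filter_def by auto
  moreover have "\<exists>d\<in>D. d \<in> f -` K" if D: "directed D" "Sup D \<in> f -` K" for D
  proof -
    have "Sup (f ` D) \<in> K" using D assms(1) by simp
    then obtain d where "d \<in> f ` D" "d \<in> K"
      using K dir[OF D(1)] unfolding scott_open_filter_def by blast
    then show ?thesis by auto
  qed
  ultimately show ?thesis unfolding scott_open_filter_def by blast
qed

lemma sigma_ext_eq_pi_ext: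
  fixes eL :: "'a::frame \<Rightarrow> 'c::complete_lattice" and eM :: "'b::frame \<Rightarrow> 'd::complete_lattice"
  assumes eL: "canonical_extension eL" and eM: "canonical_extension eM"
    and f: "\<And>D. directed D \<Longrightarrow> f (Sup D) = Sup (f ` D)" "f top = top"
      "\<And>a b. f (inf a b) = inf (f a) (f b)"
  shows "sigma_ext eL eM f = pi_ext eL eM f"
proof (rule ext, rule antisym)
  fix u
  show "sigma_ext eL eM f u \<le> pi_ext eL eM f u"
    unfolding sigma_ext_def pi_ext_def
  proof (rule Sup_least, rule Inf_greatest, clarify)
    fix K a assume K: "scott_open_filter K" "Inf (eL ` K) \<le> u" and a: "u \<le> eL a"
    then have "a \<in> K"
      using eL order_trans[OF K(2) a] unfolding canonical_extension_def by blast
    then show "Inf (eM ` f ` K) \<le> eM (f a)" by (intro Inf_lower) auto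
  qed
  have denseL: "x \<le> y" if "\<And>K a. scott_open_filter K \<Longrightarrow> Inf (eL ` K) \<le> x \<Longrightarrow> y \<le> eL a
      \<Longrightarrow> Inf (eL ` K) \<le> eL a" for x y
    using eL that unfolding canonical_extension_def by blast
  have denseM: "x \<le> y" if "\<And>K a. scott_open_filter K \<Longrightarrow> Inf (eM ` K) \<le> x \<Longrightarrow> y \<le> eM a
      \<Longrightarrow> Inf (eM ` K) \<le> eM a" for x y
    using eM that unfolding canonical_extension_def by blast
  show "pi_ext eL eM f u \<le> sigma_ext eL eM f u"
  proof (rule denseM)
    fix K b assume K: "scott_open_filter K" "Inf (eM ` K) \<le> pi_ext eL eM f u"
      and b: "sigma_ext eL eM f u \<le> eM b"
    have SO: "scott_open_filter (f -` K)"
      using scott_open_filter_vimage[OF f K(1)] by blast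
    have "Inf (eL ` (f -` K)) \<le> u"
    proof (rule denseL)
      fix K' a assume K': "Inf (eL ` K') \<le> Inf (eL ` (f -` K))" and a: "u \<le> eL a"
      have "pi_ext eL eM f u \<le> eM (f a)"
        using a unfolding pi_ext_def by (auto intro: Inf_lower)
      then have "f a \<in> K"
        using eM K order_trans unfolding canonical_extension_def by blast
      then have "Inf (eL ` (f -` K)) \<le> eL a" by (auto intro: Inf_lower)
      then show "Inf (eL ` K') \<le> eL a" using K' by (rule order_trans[rotated])
    qed
    then have "Inf (eM ` f ` (f -` K)) \<le> sigma_ext eL eM f u"
      using SO unfolding sigma_ext_def by (intro Sup_upper) blast
    moreover have "Inf (eM ` K) \<le> Inf (eM ` f ` (f -` K))"
      by (rule Inf_superset_mono) auto
    ultimately show "Inf (eM ` K) \<le> eM b" using b by (meson order_trans)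
  qed
qed

lemma delta_ext_eq:
  fixes eL :: "'a::frame \<Rightarrow> 'c::complete_lattice" and eM :: "'b::frame \<Rightarrow> 'd::complete_lattice"
  assumes "canonical_extension eL" and "canonical_extension eM"
    and "\<And>D. directed D \<Longrightarrow> f (Sup D) = Sup (f ` D)" "f top = top"
      "\<And>a b. f (inf a b) = inf (f a) (f b)"
  shows "delta_ext eL eM f = sigma_ext eL eM f" and "delta_ext eL eM f = pi_ext eL eM f"
  using sigma_ext_eq_pi_ext[OF assms] unfolding delta_ext_def by auto

end

(* The extension h^delta is characterised by two adjunctions with the generators of the canonical
   extensions. On Scott-open filters, e^(K) \<le> h^delta u iff e^(h^{-1} K) \<le> u, so h^delta
   preserves meets. On elements, h^delta u \<le> e b iff u \<le> e (r b), where r is the right adjoint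
   of h; this uses perfectness, since compactness has to be applied to the filter generated
   by h[K]. So h^delta preserves joins. *)
theory Submission
  imports Defs
begin

lemma canonical_extension_mono: "canonical_extension e \<Longrightarrow> mono e"
  unfolding canonical_extension_def by blast

lemma canonical_extension_compact:
  "\<lbrakk>canonical_extension e; scott_open_filter K; Inf (e ` K) \<le> e a\<rbrakk> \<Longrightarrow> a \<in> K"
  unfolding canonical_extension_def by blast

text \<open>Meet-density of the points \<open>e a\<close>, extracted from the two-sided density
  axiom: a filter meet below \<open>u\<close> lies below each \<open>e a\<close> above
  \<open>v\<close> by transitivity through \<open>u\<close>.\<close>

lemma canonical_extension_le_by_elements:
  assumes "canonical_extension e" "\<And>a. v \<le> e a \<Longrightarrow> u \<le> e a"
  shows "u \<le> v"
proof -
  have "Inf (e ` K) \<le> e a" if "Inf (e ` K) \<le> u" "v \<le> e a" for K a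
    using that(1) assms(2)[OF that(2)] by (rule order_trans)
  then show ?thesis
    using assms(1) unfolding canonical_extension_def by blast
qed

lemma canonical_extension_le_by_filters:
  assumes "canonical_extension e"
    "\<And>K. scott_open_filter K \<Longrightarrow> Inf (e ` K) \<le> u \<Longrightarrow> Inf (e ` K) \<le> v"
  shows "u \<le> v"
proof -
  have "Inf (e ` K) \<le> e a" if "scott_open_filter K" "Inf (e ` K) \<le> u" "v \<le> e a" for K a
    using assms(2)[OF that(1,2)] that(3) by (rule order_trans)
  then show ?thesis
    using assms(1) unfolding canonical_extension_def by blast
qed

lemma frame_hom_simps:
  assumes "frame_hom h"
  shows "h (Sup A) = Sup (h ` A)" "h top = top" "h (inf a b) = inf (h a) (h b)"
  using assms unfolding frame_hom_def by blast+

lemma frame_hom_mono: "frame_hom h \<Longrightarrow> mono h"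
  by (rule monoI) (metis frame_hom_simps(3) inf.absorb_iff1)

text \<open>Since \<open>h\<close> preserves binary meets, the upward closure of the image is
  already closed under meets, so no finite meets have to be added.\<close>

lemma generated_filter_image:
  assumes h: "frame_hom h" and K: "lattice_filter K"
  shows "generated_filter (h ` K) = {b. \<exists>a\<in>K. h a \<le> b}" (is "_ = ?F")
proof
  have "lattice_filter ?F"
    unfolding lattice_filter_def
  proof (intro conjI allI ballI impI)
    show "top \<in> ?F" using K unfolding lattice_filter_def by auto
  next
    fix b c assume "b \<in> ?F" "c \<in> ?F"
    then obtain x y where xy: "x \<in> K" "h x \<le> b" "y \<in> K" "h y \<le> c" by blast
    then have "inf x y \<in> K" using K unfolding lattice_filter_def by blast
    moreover have "h (inf x y) \<le> inf b c"
      using xy by (simp add: frame_hom_simps(3)[OF h] le_infI1 le_infI2)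
    ultimately show "inf b c \<in> ?F" by blast
  qed (blast intro: order_trans)
  then show "generated_filter (h ` K) \<subseteq> ?F"
    unfolding generated_filter_def by blast
  show "?F \<subseteq> generated_filter (h ` K)"
    unfolding generated_filter_def lattice_filter_def by blast
qed

lemma perfect_Inf_image_le_iff:
  assumes eM: "canonical_extension eM" and h: "frame_hom h" "perfect_map h"
    and K: "scott_open_filter K"
  shows "Inf (eM ` h ` K) \<le> eM b \<longleftrightarrow> (\<exists>a\<in>K. h a \<le> b)"
proof
  let ?F = "{b. \<exists>a\<in>K. h a \<le> b}"
  have "lattice_filter K" using K unfolding scott_open_filter_def by blast
  then have F: "scott_open_filter ?F"
    using h K generated_filter_image[OF h(1)] unfolding perfect_map_def by metis
  assume le: "Inf (eM ` h ` K) \<le> eM b"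
  \<comment> \<open>Passing to the larger set \<open>?F\<close> only lowers the meet, so the bound
    \<open>eM b\<close> survives.\<close>
  have "Inf (eM ` ?F) \<le> Inf (eM ` h ` K)"
    by (rule Inf_superset_mono) auto
  from canonical_extension_compact[OF eM F order_trans[OF this le]]
  show "\<exists>a\<in>K. h a \<le> b" by blast
next
  assume "\<exists>a\<in>K. h a \<le> b"
  then show "Inf (eM ` h ` K) \<le> eM b"
    using canonical_extension_mono[OF eM] by (auto intro: Inf_lower2 dest: monoD)
qed

text \<open>The \<open>Sup\<close> is the right adjoint of \<open>h\<close> at \<open>b\<close>. The
  forward direction reads the extension as \<open>sigma_ext\<close>, the converse as
  \<open>pi_ext\<close>.\<close>

lemma delta_ext_le_iff:
  assumes eL: "canonical_extension eL" and eM: "canonical_extension eM"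
    and h: "frame_hom h" "perfect_map h"
  shows "delta_ext eL eM h u \<le> eM b \<longleftrightarrow> u \<le> eL (Sup {a. h a \<le> b})"
    (is "_ \<longleftrightarrow> u \<le> eL ?r")
proof
  note delta = delta_ext_eq[OF eL eM frame_hom_simps[OF h(1)]]
  show "u \<le> eL ?r" if le: "delta_ext eL eM h u \<le> eM b"
  proof (rule canonical_extension_le_by_filters[OF eL])
    fix K assume K: "scott_open_filter K" "Inf (eL ` K) \<le> u"
    then have "Inf (eM ` h ` K) \<le> delta_ext eL eM h u"
      unfolding delta sigma_ext_def by (intro Sup_upper) blast
    then obtain a where a: "a \<in> K" "h a \<le> b"
      using le perfect_Inf_image_le_iff[OF eM h K(1)] by (meson order_trans)
    then have "a \<le> ?r" by (auto intro: Sup_upper)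
    then have "eL a \<le> eL ?r" by (rule monoD[OF canonical_extension_mono[OF eL]])
    then show "Inf (eL ` K) \<le> eL ?r" using a by (intro Inf_lower2) auto
  qed
  show "delta_ext eL eM h u \<le> eM b" if "u \<le> eL ?r"
  proof -
    have "delta_ext eL eM h u \<le> eM (h ?r)"
      using that unfolding delta(2) pi_ext_def by (intro Inf_lower) blast
    \<comment> \<open>The counit of the adjunction, valid because \<open>h\<close> preserves
      arbitrary joins.\<close>
    also have "h ?r \<le> b"
      by (auto simp: frame_hom_simps(1)[OF h(1)] intro: Sup_least)
    then have "eM (h ?r) \<le> eM b"
      by (rule monoD[OF canonical_extension_mono[OF eM]])
    finally show ?thesis .
  qed
qed

lemma Inf_le_delta_ext_iff:
  assumes eL: "canonical_extension eL" and eM: "canonical_extension eM"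
    and h: "frame_hom h" and K: "scott_open_filter K"
  shows "Inf (eM ` K) \<le> delta_ext eL eM h u \<longleftrightarrow> Inf (eL ` (h -` K)) \<le> u"
proof
  note delta = delta_ext_eq[OF eL eM frame_hom_simps[OF h]]
  show "Inf (eL ` (h -` K)) \<le> u" if "Inf (eM ` K) \<le> delta_ext eL eM h u"
  proof (rule canonical_extension_le_by_elements[OF eL])
    fix a assume "u \<le> eL a"
    then have "delta_ext eL eM h u \<le> eM (h a)"
      unfolding delta(2) pi_ext_def by (intro Inf_lower) blast
    with that have "Inf (eM ` K) \<le> eM (h a)" by (rule order_trans)
    then have "h a \<in> K" by (rule canonical_extension_compact[OF eM K])
    then show "Inf (eL ` (h -` K)) \<le> eL a" by (auto intro: Inf_lower)
  qed
  show "Inf (eM ` K) \<le> delta_ext eL eM h u" if "Inf (eL ` (h -` K)) \<le> u"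
  proof -
    have "Inf (eM ` K) \<le> Inf (eM ` h ` (h -` K))"
      by (rule Inf_superset_mono) auto
    also have "\<dots> \<le> delta_ext eL eM h u"
      using that scott_open_filter_vimage[OF frame_hom_simps[OF h] K]
      unfolding delta(1) sigma_ext_def by (intro Sup_upper) blast
    finally show ?thesis .
  qed
qed

theorem theorem6p6:
  fixes eL :: "'a::frame \<Rightarrow> 'c::complete_lattice"
    and eM :: "'b::frame \<Rightarrow> 'd::complete_lattice"
    and h :: "'a \<Rightarrow> 'b"
  assumes "canonical_extension eL" and "canonical_extension eM"
    and "frame_hom h" and "perfect_map h"
  shows "complete_lattice_hom (delta_ext eL eM h)"
proof -
  let ?d = "delta_ext eL eM h"
  note le_iff = delta_ext_le_iff[OF assms]
  note ge_iff = Inf_le_delta_ext_iff[OF assms(1-3)]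
  have "?d (Sup A) = Sup (?d ` A)" for A
  proof (rule antisym)
    \<comment> \<open>Tested against \<open>eM b\<close>, either side says that every member of
      \<open>A\<close> lies below \<open>eL\<close> of the right adjoint at
      \<open>b\<close>.\<close>
    show "?d (Sup A) \<le> Sup (?d ` A)"
      by (rule canonical_extension_le_by_elements[OF assms(2)]) (simp add: le_iff Sup_le_iff)
    show "Sup (?d ` A) \<le> ?d (Sup A)"
      by (rule canonical_extension_le_by_elements[OF assms(2)]) (simp add: le_iff Sup_le_iff)
  qed
  moreover have "?d (Inf A) = Inf (?d ` A)" for A
  proof (rule antisym)
    show "?d (Inf A) \<le> Inf (?d ` A)"
      by (rule canonical_extension_le_by_filters[OF assms(2)]) (simp add: ge_iff le_Inf_iff)
    show "Inf (?d ` A) \<le> ?d (Inf A)"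
      by (rule canonical_extension_le_by_filters[OF assms(2)]) (simp add: ge_iff le_Inf_iff)
  qed
  ultimately show ?thesis unfolding complete_lattice_hom_def by blast
qed

end
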